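(* Let $\mathcal{A} = (A, \vee, \wedge, 0, 1, \widehat{\ })$ be a Boolean algebra. Define on $A \times A$ the operations $$(a, b) \vee (c, d) = (a \vee c,\ b \vee d),$$ $$(a, b) \wedge (c, d) = \bigl(a \wedge c,\ (a \wedge d) \vee (b \wedge c) \vee (b \wedge d)\bigr),$$ $$\widehat{(a, b)} = (\widehat{a}, \widehat{b}).$$ Then $(A \times A, \vee, (0,0), \wedge, (1,0), \widehat{\ })$ is a weak B-ring, with $\vee$ as first operation (neutral element $(0,0)$) and $\wedge$ as second operation (neutral element $(1,0)$).
   Context: In a Boolean algebra $(A, \vee, \wedge, 0, 1, \widehat{\ })$, $\widehat{a}$ denotes the complement of $a$. A weak B-ring is a 6-tuple $(X, \vee, 0, \cdot, 1, \widehat{\ })$, where $X$ is a set, $\vee$ and $\cdot$ are binary operations on $X$, $0, 1 \in X$, and $\widehat{\ }$ is a unary operation on $X$, such that for all $x, y, z \in X$: (1) $(x \vee y) \vee z = x \vee (y \vee z)$; (2) $x \vee y = y \vee x$; (3) $x \vee 0 = x$; (4) $(x \cdot y) \cdot z = x \cdot (y \cdot z)$; (5) $x \cdot 1 = x = 1 \cdot x$; (6) $x \cdot 0 = 0 = 0 \cdot x$; (7) $x \cdot (y \vee z) = (x \cdot y) \vee (x \cdot z)$; (8) $(x \vee y) \cdot z = (x \cdot z) \vee (y \cdot z)$; (9) $\widehat{\widehat{x}} = x$; (10) $x \vee \widehat{x} = \widehat{x} \vee x$; (11) $x \cdot \widehat{x} = \widehat{x} \cdot x$. *)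

theory Defs
  imports Main
begin

text \<open>
  The underlying set \<open>X\<close> of a weak B-ring is the type \<open>'x\<close>, as in the library locale
  \<^locale>\<open>abstract_boolean_algebra\<close>. The order of the parameters is that of the 6-tuple
  \<open>(X, \<or>, 0, \<cdot>, 1, ^)\<close>. No law relating \<open>neg x\<close> to \<open>zero\<close> and \<open>one\<close> is required: the last
  two axioms only assert commutation, and the second to last is already an instance of
  \<open>join_commute\<close>.
\<close>

locale weak_B_ring =
  fixes join :: "'x \<Rightarrow> 'x \<Rightarrow> 'x"
    and zero :: 'x
    and times :: "'x \<Rightarrow> 'x \<Rightarrow> 'x"
    and one :: 'x
    and neg :: "'x \<Rightarrow> 'x"
  assumes join_assoc: "join (join x y) z = join x (join y z)"
    and join_commute: "join x y = join y x"
    and join_zero: "join x zero = x"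
    and times_assoc: "times (times x y) z = times x (times y z)"
    and times_one: "times x one = x" "times one x = x"
    and times_zero: "times x zero = zero" "times zero x = zero"
    and times_join_distrib_left: "times x (join y z) = join (times x y) (times x z)"
    and times_join_distrib_right: "times (join x y) z = join (times x z) (times y z)"
    and neg_neg: "neg (neg x) = x"
    and join_neg_commute: "join x (neg x) = join (neg x) x"
    and times_neg_commute: "times x (neg x) = times (neg x) x"

fun pair_join :: "('a \<Rightarrow> 'a \<Rightarrow> 'a) \<Rightarrow> 'a \<times> 'a \<Rightarrow> 'a \<times> 'a \<Rightarrow> 'a \<times> 'a" where
  "pair_join join (a, b) (c, d) = (join a c, join b d)"

fun pair_meet ::
  "('a \<Rightarrow> 'a \<Rightarrow> 'a) \<Rightarrow> ('a \<Rightarrow> 'a \<Rightarrow> 'a) \<Rightarrow> 'a \<times> 'a \<Rightarrow> 'a \<times> 'a \<Rightarrow> 'a \<times> 'a" where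
  "pair_meet meet join (a, b) (c, d) =
     (meet a c, join (join (meet a d) (meet b c)) (meet b d))"

fun pair_neg :: "('a \<Rightarrow> 'a) \<Rightarrow> 'a \<times> 'a \<Rightarrow> 'a \<times> 'a" where
  "pair_neg neg (a, b) = (neg a, neg b)"

end

theory Submission
  imports Defs
begin

text \<open>
  A pair \<open>(a, b)\<close> behaves like the linear polynomial \<open>a \<or> b e\<close> over the semiring
  \<open>(A, \<or>, \<and>)\<close>, with a central idempotent \<open>e\<close>; expanding
  \<open>(a \<or> b e) \<and> (c \<or> d e)\<close> with \<open>e \<and> e = e\<close> gives the pair multiplication. Hence the semiring
  laws are inherited, and the multiplication is even commutative.
\<close>

theorem theorem5p8:
  fixes join meet :: "'a \<Rightarrow> 'a \<Rightarrow> 'a"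
    and zero one :: 'a
    and neg :: "'a \<Rightarrow> 'a"
  assumes "abstract_boolean_algebra meet join neg zero one"
  shows "weak_B_ring (pair_join join) (zero, zero) (pair_meet meet join) (one, zero) (pair_neg neg)"
proof -
  interpret abstract_boolean_algebra meet join neg zero one
    by (fact assms)
  note ac = conj.assoc conj.commute conj.left_commute disj.assoc disj.commute disj.left_commute
  \<comment> \<open>Only meet is distributed over join, so each component becomes a join of meets,
    which \<open>ac\<close> then compares up to order and bracketing.\<close>
  note distrib = conj_disj_distrib conj_disj_distrib2
  show ?thesis
  proof
    fix x y z :: "'a \<times> 'a"
    obtain a b c d e f where [simp]: "x = (a, b)" "y = (c, d)" "z = (e, f)"
      by (metis surj_pair)
    show "pair_join join (pair_join join x y) z = pair_join join x (pair_join join y z)"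
      by (simp add: ac)
    show "pair_join join x y = pair_join join y x"
      by (simp add: ac)
    show "pair_join join x (zero, zero) = x"
      by simp
    \<comment> \<open>Either bracketing has as second component the join of the seven meets taking
      one entry from each pair and at least one second entry.\<close>
    show "pair_meet meet join (pair_meet meet join x y) z =
        pair_meet meet join x (pair_meet meet join y z)"
      by (simp add: distrib ac)
    show "pair_meet meet join x (one, zero) = x" "pair_meet meet join (one, zero) x = x"
      by simp_all
    show "pair_meet meet join x (zero, zero) = (zero, zero)"
      "pair_meet meet join (zero, zero) x = (zero, zero)"
      by simp_all
    show "pair_meet meet join x (pair_join join y z) =
        pair_join join (pair_meet meet join x y) (pair_meet meet join x z)"
      by (simp add: distrib ac)
    show "pair_meet meet join (pair_join join x y) z =
        pair_join join (pair_meet meet join x z) (pair_meet meet join y z)"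
      by (simp add: distrib ac)
    show "pair_neg neg (pair_neg neg x) = x"
      by simp
    show "pair_join join x (pair_neg neg x) = pair_join join (pair_neg neg x) x"
      by (simp add: ac)
    \<comment> \<open>Exchanging the two factors only swaps the mixed terms of the second
      component.\<close>
    show "pair_meet meet join x (pair_neg neg x) = pair_meet meet join (pair_neg neg x) x"
      by (simp add: ac)
  qed
qed

end
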